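(* Let $(W,R)$ be a Coxeter system with $R$ finite and non-empty, and let $w$ be a Coxeter element of $W$. Then $w$ has the ancestor property, that is, among the involution prefixes of $w$ there is exactly one of maximal length, and this unique element $a(w)$ is $$a(w) = \prod_{r\in D(w)} r,$$ where $D(w)$ is the left descent set of $w$ (the elements of $D(w)$ commute pairwise, so the product is well defined).
   Context: $(W,R)$ is a Coxeter system, where $R$ is the set of simple reflections, and $\ell(w)$ denotes the length of $w\in W$ with respect to $R$ (with $\ell(1)=0$). A Coxeter element of $W$ is a product of all the simple reflections in some order, with each $r\in R$ appearing exactly once. The left descent set of $w$ is $D(w)=\{r\in R:\ell(rw)<\ell(w)\}$. An element $u\in W$ is a prefix of $w$ if $w=uv$ for some $v\in W$ with $\ell(w)=\ell(u)+\ell(v)$ (equivalently, some reduced expression for $u$ can be extended on the right to a reduced expression for $w$). An involution is an element of order exactly $2$. Let $\mathcal{IP}(w)$ be the set of prefixes of $w$ that are involutions (the involution prefixes of $w$), and let $A(w)=\{u\in\mathcal{IP}(w):\ell(u)=\max_{v\in\mathcal{IP}(w)}\ell(v)\}$. A non-identity element $w$ has the ancestor property if $|A(w)|=1$; the unique element of $A(w)$ is then called the ancestor of $w$ and denoted $a(w)$. *)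

theory Defs
  imports "HOL-Algebra.Multiplicative_Group" "HOL-Algebra.Generated_Groups"
begin

text \<open>Group presentations. An element of the free group on \<open>S\<close> is represented by words in
  \<open>S \<times> bool\<close>, where \<open>(x, True)\<close> stands for \<open>x\<close> and \<open>(x, False)\<close> for its formal inverse.
  \<open>presentation_eq S Q\<close> is equality of such words in the group \<open>\<langle>S | Q\<rangle>\<close>.\<close>

inductive presentation_eq ::
  "'a set \<Rightarrow> ('a \<times> bool) list set \<Rightarrow> ('a \<times> bool) list \<Rightarrow> ('a \<times> bool) list \<Rightarrow> bool"
  for S Q where
  refl: "presentation_eq S Q p p"
| sym: "presentation_eq S Q p q \<Longrightarrow> presentation_eq S Q q p"
| trans: "presentation_eq S Q p q \<Longrightarrow> presentation_eq S Q q t \<Longrightarrow> presentation_eq S Q p t"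
| cancel: "x \<in> S \<Longrightarrow> set p \<subseteq> S \<times> UNIV \<Longrightarrow> set q \<subseteq> S \<times> UNIV \<Longrightarrow>
    presentation_eq S Q (p @ [(x, b), (x, \<not> b)] @ q) (p @ q)"
| relator: "t \<in> Q \<Longrightarrow> set p \<subseteq> S \<times> UNIV \<Longrightarrow> set q \<subseteq> S \<times> UNIV \<Longrightarrow>
    presentation_eq S Q (p @ t @ q) (p @ q)"

definition word_value :: "('a, 'b) monoid_scheme \<Rightarrow> ('a \<times> bool) list \<Rightarrow> 'a" where
  "word_value G p =
     foldr (\<lambda>(x, b) y. (if b then x else inv\<^bsub>G\<^esub> x) \<otimes>\<^bsub>G\<^esub> y) p \<one>\<^bsub>G\<^esub>"

definition presented_by :: "('a, 'b) monoid_scheme \<Rightarrow> 'a set \<Rightarrow> ('a \<times> bool) list set \<Rightarrow> bool" where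
  "presented_by G S Q \<longleftrightarrow>
     S \<subseteq> carrier G \<and> generate G S = carrier G \<and>
     (\<forall>p. set p \<subseteq> S \<times> UNIV \<longrightarrow> (word_value G p = \<one>\<^bsub>G\<^esub> \<longleftrightarrow> presentation_eq S Q p []))"

text \<open>The entry \<open>0\<close> of a Coxeter matrix encodes \<open>\<infinity>\<close>; the corresponding relator is the empty word.\<close>

definition coxeter_matrix :: "'a set \<Rightarrow> ('a \<Rightarrow> 'a \<Rightarrow> nat) \<Rightarrow> bool" where
  "coxeter_matrix R m \<longleftrightarrow>
     (\<forall>r\<in>R. m r r = 1) \<and>
     (\<forall>r\<in>R. \<forall>s\<in>R. r \<noteq> s \<longrightarrow> m r s = m s r \<and> (m r s = 0 \<or> m r s \<ge> 2))"

definition coxeter_relators :: "'a set \<Rightarrow> ('a \<Rightarrow> 'a \<Rightarrow> nat) \<Rightarrow> ('a \<times> bool) list set" where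
  "coxeter_relators R m =
     {concat (replicate (m r s) [(r, True), (s, True)]) | r s. r \<in> R \<and> s \<in> R}"

definition coxeter_system :: "('a, 'b) monoid_scheme \<Rightarrow> 'a set \<Rightarrow> bool" where
  "coxeter_system W R \<longleftrightarrow>
     group W \<and> (\<exists>m. coxeter_matrix R m \<and> presented_by W R (coxeter_relators R m))"

definition cox_length :: "('a, 'b) monoid_scheme \<Rightarrow> 'a set \<Rightarrow> 'a \<Rightarrow> nat" where
  "cox_length W R w =
     (LEAST n. \<exists>rs. set rs \<subseteq> R \<and> length rs = n \<and> foldr (\<otimes>\<^bsub>W\<^esub>) rs \<one>\<^bsub>W\<^esub> = w)"

definition coxeter_element :: "('a, 'b) monoid_scheme \<Rightarrow> 'a set \<Rightarrow> 'a \<Rightarrow> bool" where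
  "coxeter_element W R w \<longleftrightarrow>
     (\<exists>rs. distinct rs \<and> set rs = R \<and> w = foldr (\<otimes>\<^bsub>W\<^esub>) rs \<one>\<^bsub>W\<^esub>)"

definition left_descents :: "('a, 'b) monoid_scheme \<Rightarrow> 'a set \<Rightarrow> 'a \<Rightarrow> 'a set" where
  "left_descents W R w = {r \<in> R. cox_length W R (r \<otimes>\<^bsub>W\<^esub> w) < cox_length W R w}"

definition is_prefix :: "('a, 'b) monoid_scheme \<Rightarrow> 'a set \<Rightarrow> 'a \<Rightarrow> 'a \<Rightarrow> bool" where
  "is_prefix W R u w \<longleftrightarrow> u \<in> carrier W \<and>
     (\<exists>v\<in>carrier W. w = u \<otimes>\<^bsub>W\<^esub> v \<and> cox_length W R w = cox_length W R u + cox_length W R v)"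

definition involution :: "('a, 'b) monoid_scheme \<Rightarrow> 'a \<Rightarrow> bool" where
  "involution W u \<longleftrightarrow> u \<in> carrier W \<and> group.ord W u = 2"

definition involution_prefixes :: "('a, 'b) monoid_scheme \<Rightarrow> 'a set \<Rightarrow> 'a \<Rightarrow> 'a set" where
  "involution_prefixes W R w = {u. is_prefix W R u w \<and> involution W u}"

text \<open>The set of lengths below is bounded by \<open>cox_length W R w\<close>, so \<open>Max\<close> is meaningful unless
  there is no involution prefix at all, in which case the set defined is empty.\<close>

definition max_involution_prefixes :: "('a, 'b) monoid_scheme \<Rightarrow> 'a set \<Rightarrow> 'a \<Rightarrow> 'a set" where
  "max_involution_prefixes W R w =
     {u \<in> involution_prefixes W R w.
        cox_length W R u = Max (cox_length W R ` involution_prefixes W R w)}"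

definition ancestor_property :: "('a, 'b) monoid_scheme \<Rightarrow> 'a set \<Rightarrow> 'a \<Rightarrow> bool" where
  "ancestor_property W R w \<longleftrightarrow> w \<noteq> \<one>\<^bsub>W\<^esub> \<and> card (max_involution_prefixes W R w) = 1"

definition ancestor :: "('a, 'b) monoid_scheme \<Rightarrow> 'a set \<Rightarrow> 'a \<Rightarrow> 'a" where
  "ancestor W R w = (THE u. u \<in> max_involution_prefixes W R w)"

end

theory Submission
  imports Defs
begin

text \<open>Everything rests on one invariant of words. To a word \<open>s\<^sub>1 \<dots> s\<^sub>n\<close> in the
  simple reflections attach the list of reflections
  \<open>t\<^sub>i = (s\<^sub>1 \<dots> s\<^sub>i\<^sub>-\<^sub>1) s\<^sub>i (s\<^sub>1 \<dots> s\<^sub>i\<^sub>-\<^sub>1)\<inverse>\<close>.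
  The parity with which a given element occurs in this list depends only on the group
  element that the word represents, because a Coxeter relator contributes every reflection an even
  number of times (lemma \<open>refls_parity\<close>). So a word whose reflections are distinct is
  reduced. Moreover, if the reflection \<open>t\<close> of a word is the one at the letter \<open>x\<close>
  following the initial segment \<open>a\<close>, then \<open>t a = a x\<close>, so that multiplying
  the word by \<open>t\<close> on the left deletes this \<open>x\<close>. It follows that a simple reflection is
  never a product of the other ones (lemma \<open>gen_in_support\<close>).

  For words without repeated letters this last fact replaces the general solution of the word
  problem. Such a word is reduced, since a coincidence of reflections would express a letter by
  other letters. If \<open>r a = a r\<close> for such a word \<open>a\<close> not containing \<open>r\<close>,
  then \<open>r\<close> commutes with each letter of \<open>a\<close>. Hence the left descents of a
  Coxeter element, written as a word, are the letters that commute with all earlier letters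
  (lemma \<open>descent_iff_commutes_before\<close>); of two descents one precedes the other, so they
  commute.

  An involution prefix \<open>u\<close> of a Coxeter element \<open>w\<close> has a reduced word
  \<open>q\<close> that extends to a reduced word of \<open>w\<close>, in which every simple reflection
  occurs exactly once, because a word of \<open>w\<close> cannot avoid any letter (lemma
  \<open>reduced_support\<close>). Both \<open>q\<close> and its reversal represent \<open>u\<close>,
  so the last letter of \<open>q\<close> is a descent of \<open>u\<close> and commutes with all other
  letters; stripping it off and repeating shows that all letters of \<open>q\<close> commute. Each
  of them is therefore a descent of \<open>w\<close>. Thus the involution prefixes are products of
  subsets of \<open>D(w)\<close>, the length being the size of the subset, and the product over all
  of \<open>D(w)\<close> is itself one because the descents can be moved to the front of the word.\<close>

section \<open>Words and their reflections\<close>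

locale coxeter = group W for W :: "('a, 'b) monoid_scheme" (structure) +
  fixes R :: "'a set"
  assumes system: "coxeter_system W R"
begin

definition word_prod :: "'a list \<Rightarrow> 'a" where
  "word_prod p = foldr (\<otimes>) p \<one>"

definition conj_by :: "'a \<Rightarrow> 'a \<Rightarrow> 'a" where
  "conj_by g x = g \<otimes> x \<otimes> inv g"

text \<open>The reflections \<open>t\<^sub>i\<close> attached to a word, computed from the left: prepending a
  letter conjugates the reflections of the remaining word.\<close>
primrec refls :: "'a list \<Rightarrow> 'a list" where
  "refls [] = []"
| "refls (r # p) = r # map (conj_by r) (refls p)"

lemma word_prod_Nil [simp]: "word_prod [] = \<one>"
  and word_prod_Cons [simp]: "word_prod (r # p) = r \<otimes> word_prod p"
  by (simp_all add: word_prod_def)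

lemma gens_closed: "R \<subseteq> carrier W"
  and gens_generate: "generate W R = carrier W"
  using system by (auto simp: coxeter_system_def presented_by_def)

lemma gen_closed [simp]: "r \<in> R \<Longrightarrow> r \<in> carrier W"
  using gens_closed by auto

lemma word_prod_closed [simp]: "set p \<subseteq> R \<Longrightarrow> word_prod p \<in> carrier W"
  by (induction p) auto

lemma word_prod_append:
  "set p \<subseteq> R \<Longrightarrow> set q \<subseteq> R \<Longrightarrow> word_prod (p @ q) = word_prod p \<otimes> word_prod q"
  by (induction p) (auto simp: m_assoc)

lemma conj_by_closed [simp]:
  "g \<in> carrier W \<Longrightarrow> x \<in> carrier W \<Longrightarrow> conj_by g x \<in> carrier W"
  by (simp add: conj_by_def)

lemma conj_by_one: "x \<in> carrier W \<Longrightarrow> conj_by \<one> x = x"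
  by (simp add: conj_by_def)

lemma conj_by_mult:
  "\<lbrakk>g \<in> carrier W; h \<in> carrier W; x \<in> carrier W\<rbrakk> \<Longrightarrow>
    conj_by (g \<otimes> h) x = conj_by g (conj_by h x)"
  by (simp add: conj_by_def inv_mult_group m_assoc)

lemma conj_by_eq_iff:
  "\<lbrakk>g \<in> carrier W; x \<in> carrier W; y \<in> carrier W\<rbrakk> \<Longrightarrow>
    conj_by g x = y \<longleftrightarrow> g \<otimes> x = y \<otimes> g"
  by (metis conj_by_def inv_solve_right m_closed)

lemma inj_on_conj_by: "g \<in> carrier W \<Longrightarrow> inj_on (conj_by g) (carrier W)"
  by (rule inj_onI) (simp add: conj_by_def)

lemma refls_closed: "set p \<subseteq> R \<Longrightarrow> set (refls p) \<subseteq> carrier W"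
  by (induction p) auto

lemma length_refls [simp]: "length (refls p) = length p"
  by (induction p) auto

lemma refls_append:
  assumes "set p \<subseteq> R" "set q \<subseteq> R"
  shows "refls (p @ q) = refls p @ map (conj_by (word_prod p)) (refls q)"
  using assms
proof (induction p)
  case Nil
  then show ?case
    using refls_closed[of q] by (auto simp: conj_by_one intro!: map_idI[symmetric])
next
  case (Cons r p)
  then show ?case
    using refls_closed[of q] by (auto simp: conj_by_mult)
qed

lemma word_value_positive: "word_value W (map (\<lambda>r. (r, True)) p) = word_prod p"
  by (induction p) (auto simp: word_value_def)

section \<open>Parity of reflections is an invariant of the group element\<close>

lemma relator_map:
  "concat (replicate n [(r, True), (s, True)]) = map (\<lambda>r. (r, True)) (concat (replicate n [r, s]))"
  by (induction n) auto

context
  fixes m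
  assumes m: "coxeter_matrix R m"
    and presented: "presented_by W R (coxeter_relators R m)"
begin

lemma relator_prod:
  assumes "r \<in> R" "s \<in> R"
  shows "word_prod (concat (replicate (m r s) [r, s])) = \<one>"
proof -
  let ?t = "concat (replicate (m r s) [(r, True), (s, True)])"
  have "?t \<in> coxeter_relators R m"
    using assms by (auto simp: coxeter_relators_def)
  from presentation_eq.relator[OF this, of "[]" R "[]"]
  have "presentation_eq R (coxeter_relators R m) ?t []"
    by simp
  moreover have "set ?t \<subseteq> R \<times> UNIV"
    using assms by auto
  ultimately have "word_value W ?t = \<one>"
    using presented by (auto simp: presented_by_def)
  then show ?thesis
    by (simp add: relator_map word_value_positive)
qed

lemma gen_square_of_matrix: "r \<in> R \<Longrightarrow> r \<otimes> r = \<one>"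
  using relator_prod[of r r] m by (auto simp: coxeter_matrix_def)

lemma gen_inv_of_matrix: "r \<in> R \<Longrightarrow> inv r = r"
  by (simp add: gen_square_of_matrix inv_equality)

lemma word_prod_replicate:
  "r \<in> R \<Longrightarrow> s \<in> R \<Longrightarrow> word_prod (concat (replicate n [r, s])) = (r \<otimes> s) [^] n"
proof (induction n)
  case (Suc n)
  then show ?case
    using nat_pow_Suc2[of "r \<otimes> s" n] by (simp add: m_assoc)
qed simp

text \<open>For \<open>g = r s\<close> conjugation of \<open>g\<^sup>i r\<close> by \<open>g\<close> gives
  \<open>g\<^sup>i\<^sup>+\<^sup>2 r\<close>, since \<open>r g\<inverse> = r s r = g r\<close>.\<close>
lemma refls_replicate:
  assumes rs: "r \<in> R" "s \<in> R"
  shows "refls (concat (replicate n [r, s])) = map (\<lambda>i. (r \<otimes> s) [^] i \<otimes> r) [0..<2 * n]"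
proof (induction n)
  case 0
  then show ?case by simp
next
  case (Suc n)
  let ?g = "r \<otimes> s"
  have step: "conj_by r (conj_by s (?g [^] i \<otimes> r)) = ?g [^] Suc (Suc i) \<otimes> r" for i
  proof -
    have "conj_by r (conj_by s (?g [^] i \<otimes> r)) = ?g \<otimes> (?g [^] i \<otimes> r) \<otimes> inv ?g"
      using rs by (simp add: conj_by_mult[symmetric]) (simp add: conj_by_def)
    also have "\<dots> = (?g \<otimes> ?g [^] i \<otimes> ?g) \<otimes> r"
      using rs by (simp add: inv_mult_group gen_inv_of_matrix m_assoc)
    also have "?g \<otimes> ?g [^] i \<otimes> ?g = ?g [^] Suc (Suc i)"
      using rs by (metis gen_closed m_closed nat_pow_Suc nat_pow_Suc2)
    finally show ?thesis .
  qed
  have "[0..<2 * Suc n] = 0 # 1 # map (\<lambda>i. Suc (Suc i)) [0..<2 * n]"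
    by (rule nth_equalityI) (auto simp: nth_Cons simp del: upt_Suc split: nat.split)
  moreover have "conj_by r s = ?g \<otimes> r"
    using rs by (simp add: conj_by_def gen_inv_of_matrix)
  ultimately show ?case
    using rs step by (simp add: Suc.IH comp_def)
qed

text \<open>The reflections \<open>(r s)\<^sup>i r\<close> of a relator are periodic in \<open>i\<close> with
  period \<open>m r s\<close>, and there are two periods of them. For \<open>m r s = 0\<close> the list is
  empty.\<close>
lemma refls_relator:
  assumes "r \<in> R" "s \<in> R"
  obtains L where "refls (concat (replicate (m r s) [r, s])) = L @ L"
proof
  let ?g = "r \<otimes> s" and ?n = "m r s"
  have one: "?g [^] ?n = \<one>"
    using relator_prod word_prod_replicate assms by metis
  have "[0..<2 * ?n] = [0..<?n] @ map (\<lambda>i. i + ?n) [0..<?n]"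
    by (metis add_0 map_add_upt mult_2 upt_add_eq_append zero_le)
  moreover have "?g [^] (i + ?n) = ?g [^] i" for i
    using one assms by (simp add: nat_pow_mult[symmetric])
  ultimately show "refls (concat (replicate ?n [r, s]))
      = map (\<lambda>i. ?g [^] i \<otimes> r) [0..<?n] @ map (\<lambda>i. ?g [^] i \<otimes> r) [0..<?n]"
    using assms by (simp add: refls_replicate)
qed

text \<open>Inserting a trivial word leaves the later reflections alone and adds conjugates of its own
  reflections; these are doubled, whatever identifications the conjugation may make.\<close>
lemma refls_insert_parity:
  assumes "set p \<subseteq> R" "set t \<subseteq> R" "set q \<subseteq> R"
    and "word_prod t = \<one>" "refls t = L @ L"
  shows "even (count_list (refls (p @ t @ q)) x) = even (count_list (refls (p @ q)) x)"
proof -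
  have "map (conj_by \<one>) (refls q) = refls q"
    using refls_closed[OF assms(3)] by (auto simp: conj_by_one intro!: map_idI)
  then have "refls (t @ q) = L @ L @ refls q"
    using assms by (simp add: refls_append)
  then have "refls (p @ t @ q) = refls p @ map (conj_by (word_prod p)) (L @ L @ refls q)"
    using assms(1-3) by (simp add: refls_append[of p "t @ q"])
  then show ?thesis
    using assms(1,3) by (auto simp: refls_append[of p q])
qed

text \<open>Forgetting the exponents of a word is harmless, as simple reflections are their own inverses.
  Every elementary step of a derivation inserts or removes a word whose reflections are doubled.\<close>
lemma refls_presentation_parity:
  "presentation_eq R (coxeter_relators R m) p q \<Longrightarrow>
    even (count_list (refls (map fst p)) x) = even (count_list (refls (map fst q)) x)"
proof (induction rule: presentation_eq.induct)
  case (cancel y p q b)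
  have "refls [y, y] = [y] @ [y]"
    using cancel by (simp add: conj_by_def gen_square_of_matrix gen_inv_of_matrix)
  moreover have "set (map fst p) \<subseteq> R" "set (map fst q) \<subseteq> R"
    using cancel by auto
  moreover have "word_prod [y, y] = \<one>"
    using cancel by (simp add: gen_square_of_matrix)
  ultimately show ?case
    using refls_insert_parity[of "map fst p" "[y, y]" "map fst q" "[y]" x] cancel(1) by simp
next
  case (relator t p q)
  then obtain r s where rs: "r \<in> R" "s \<in> R"
    and t: "t = concat (replicate (m r s) [(r, True), (s, True)])"
    by (auto simp: coxeter_relators_def)
  have t': "map fst t = concat (replicate (m r s) [r, s])"
    by (simp add: t relator_map comp_def)
  obtain L where "refls (map fst t) = L @ L"
    using refls_relator[OF rs] t' by metis
  moreover have "set (map fst t) \<subseteq> R"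
    unfolding t' using rs by auto
  moreover have "word_prod (map fst t) = \<one>"
    unfolding t' by (rule relator_prod[OF rs])
  moreover have "set (map fst p) \<subseteq> R" "set (map fst q) \<subseteq> R"
    using relator by auto
  ultimately show ?case
    using refls_insert_parity[of "map fst p" "map fst t" "map fst q" L x] by simp
qed auto

lemma refls_even_of_trivial:
  assumes "set p \<subseteq> R" "word_prod p = \<one>"
  shows "even (count_list (refls p) x)"
proof -
  let ?p = "map (\<lambda>r. (r, True)) p"
  have "set ?p \<subseteq> R \<times> UNIV" "word_value W ?p = \<one>"
    using assms by (auto simp: word_value_positive)
  then have "presentation_eq R (coxeter_relators R m) ?p []"
    using presented unfolding presented_by_def by blast
  from refls_presentation_parity[OF this, of x] show ?thesis
    by (simp add: comp_def)
qed

end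

lemma obtain_matrix:
  obtains m where "coxeter_matrix R m" "presented_by W R (coxeter_relators R m)"
  using system by (auto simp: coxeter_system_def)

lemma gen_square [simp]: "r \<in> R \<Longrightarrow> r \<otimes> r = \<one>"
  by (rule obtain_matrix) (rule gen_square_of_matrix)

lemma gen_inv [simp]: "r \<in> R \<Longrightarrow> inv r = r"
  by (simp add: inv_equality)

lemma gen_cancel [simp]: "r \<in> R \<Longrightarrow> x \<in> carrier W \<Longrightarrow> r \<otimes> (r \<otimes> x) = x"
  by (simp flip: m_assoc)

lemma word_prod_rev: "set p \<subseteq> R \<Longrightarrow> word_prod (rev p) = inv (word_prod p)"
  by (induction p) (auto simp: word_prod_append inv_mult_group)

text \<open>Appending the inverse of the common group element turns both words into trivial ones, and adds
  the same reflections to both.\<close>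
lemma refls_parity:
  assumes "set p \<subseteq> R" "set q \<subseteq> R" "word_prod p = word_prod q"
  shows "even (count_list (refls p) x) = even (count_list (refls q) x)"
proof -
  obtain m where m: "coxeter_matrix R m" "presented_by W R (coxeter_relators R m)"
    using obtain_matrix by blast
  have "even (count_list (refls (p @ rev q)) x)"
    using assms by (intro refls_even_of_trivial[OF m]) (auto simp: word_prod_append word_prod_rev)
  moreover have "even (count_list (refls (q @ rev q)) x)"
    using assms by (intro refls_even_of_trivial[OF m]) (auto simp: word_prod_append word_prod_rev)
  ultimately show ?thesis
    using assms by (simp add: refls_append)
qed

section \<open>Exchange, deletion and support\<close>

lemma count_one: "distinct xs \<Longrightarrow> x \<in> set xs \<Longrightarrow> count_list xs x = 1"
  by (induction xs) (auto simp: count_list_0_iff)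

text \<open>Occurring exactly once is an odd multiplicity, which any other word for the same element must
  reproduce. In particular, a word with distinct reflections is a shortest one.\<close>
lemma refls_subset:
  assumes "set p \<subseteq> R" "set q \<subseteq> R" "word_prod p = word_prod q" "distinct (refls p)"
  shows "set (refls p) \<subseteq> set (refls q)"
proof
  fix t
  assume "t \<in> set (refls p)"
  then have "count_list (refls p) t = 1"
    using count_one[OF assms(4)] by simp
  then have "odd (count_list (refls q) t)"
    using refls_parity[OF assms(1-3), of t] by simp
  then show "t \<in> set (refls q)"
    by (metis count_notin even_zero)
qed

lemma exchange:
  assumes "set p \<subseteq> R" "t \<in> set (refls p)"
  obtains a x b where "p = a @ x # b" "t \<otimes> word_prod a = word_prod a \<otimes> x"
  using assms
proof (induction p arbitrary: t thesis)
  case Nil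
  then show ?case by simp
next
  case (Cons r p)
  show ?case
  proof (cases "t = r")
    case True
    then show ?thesis
      using Cons.prems(1)[of "[]" r p] Cons.prems(2) by simp
  next
    case False
    then obtain u where u: "u \<in> set (refls p)" "t = conj_by r u"
      using Cons.prems(3) by auto
    then obtain a x b where axb: "p = a @ x # b" "u \<otimes> word_prod a = word_prod a \<otimes> x"
      using Cons.IH[of u] Cons.prems(2) by auto
    have cl: "r \<in> carrier W" "x \<in> carrier W" "word_prod a \<in> carrier W" "u \<in> carrier W"
      using Cons.prems(2) axb(1) u(1) refls_closed[of p] by auto
    have "t \<otimes> (r \<otimes> word_prod a) = r \<otimes> (u \<otimes> word_prod a)"
      using cl Cons.prems(2) by (simp add: u(2) conj_by_def m_assoc)
    also have "\<dots> = r \<otimes> word_prod a \<otimes> x"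
      using cl by (simp add: axb(2) m_assoc)
    finally show ?thesis
      using Cons.prems(1)[of "r # a" x b] axb(1) by simp
  qed
qed

lemma delete_letter:
  assumes "set (a @ x # b) \<subseteq> R" "t \<in> carrier W" "t \<otimes> word_prod a = word_prod a \<otimes> x"
  shows "t \<otimes> word_prod (a @ x # b) = word_prod (a @ b)"
proof -
  have cl: "x \<in> R" "set a \<subseteq> R" "set b \<subseteq> R"
    using assms(1) by auto
  then have "t \<otimes> word_prod (a @ x # b) = (t \<otimes> word_prod a) \<otimes> (x \<otimes> word_prod b)"
    using assms(2) by (simp add: word_prod_append m_assoc)
  also have "\<dots> = word_prod a \<otimes> (x \<otimes> x) \<otimes> word_prod b"
    using cl unfolding assms(3) by (simp only: m_assoc gen_closed word_prod_closed m_closed)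
  also have "\<dots> = word_prod (a @ b)"
    using cl by (simp add: word_prod_append)
  finally show ?thesis .
qed

lemma distinct_refls_Cons:
  assumes "r \<in> R" "set p \<subseteq> R"
  shows "distinct (refls (r # p)) \<longleftrightarrow> r \<notin> set (refls p) \<and> distinct (refls p)"
proof -
  have sub: "set (refls p) \<subseteq> carrier W" and r: "r \<in> carrier W"
    using assms refls_closed by auto
  have inj: "inj_on (conj_by r) (set (refls p))"
    using inj_on_conj_by[OF r] sub inj_on_subset by blast
  have rr: "conj_by r r = r"
    using assms by (simp add: conj_by_def)
  have "r \<in> conj_by r ` set (refls p) \<longleftrightarrow> r \<in> set (refls p)"
    using inj_on_image_mem_iff[OF inj_on_conj_by[OF r] r sub] rr by simp
  then show ?thesis
    using inj by (simp add: distinct_map)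
qed

text \<open>A shortening procedure that only deletes letters: if prepending a letter to a word with distinct
  reflections creates a coincidence, then this letter and another one can be deleted together.\<close>
lemma reduce_word:
  assumes "set p \<subseteq> R"
  obtains q where "set q \<subseteq> set p" "length q \<le> length p"
    "word_prod q = word_prod p" "distinct (refls q)"
  using assms
proof (induction "length p" arbitrary: p thesis rule: less_induct)
  case less
  show ?case
  proof (cases p)
    case Nil
    then show ?thesis using less.prems(1)[of "[]"] by simp
  next
    case (Cons r p')
    then have r: "r \<in> R" and p': "set p' \<subseteq> R"
      using less.prems(2) by auto
    obtain q where q: "set q \<subseteq> set p'" "length q \<le> length p'"
      "word_prod q = word_prod p'" "distinct (refls q)"
      using less.hyps[of p'] Cons p' by auto
    have qR: "set q \<subseteq> R"
      using q(1) p' by auto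
    show ?thesis
    proof (cases "r \<in> set (refls q)")
      case False
      then have "distinct (refls (r # q))"
        using distinct_refls_Cons[OF r qR] q(4) by blast
      then show ?thesis
        using less.prems(1)[of "r # q"] q Cons by auto
    next
      case True
      then obtain a x b where axb: "q = a @ x # b" "r \<otimes> word_prod a = word_prod a \<otimes> x"
        using exchange[OF qR] by blast
      have "word_prod p = word_prod (a @ b)"
        using delete_letter[of a x b r] axb qR r q(3) Cons by simp
      moreover have "length (a @ b) < length p" "set (a @ b) \<subseteq> set p"
        using axb q Cons by auto
      moreover obtain q' where "set q' \<subseteq> set (a @ b)" "length q' \<le> length (a @ b)"
          "word_prod q' = word_prod (a @ b)" "distinct (refls q')"
        using less.hyps[of "a @ b"] calculation(2) axb(1) qR by auto
      ultimately show ?thesis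
        using less.prems(1)[of q'] by auto
    qed
  qed
qed

text \<open>No simple reflection is a product of other ones. Reduce the given word by deletions; the
  reflections of the result are then among those of the one-letter word \<open>r\<close>, so the
  result is that one-letter word.\<close>
lemma gen_in_support:
  assumes "r \<in> R" "set p \<subseteq> R" "word_prod p = r"
  shows "r \<in> set p"
proof -
  obtain q where q: "set q \<subseteq> set p" "word_prod q = r" "distinct (refls q)"
    using reduce_word[OF assms(2)] assms(3) by metis
  have "set (refls q) \<subseteq> set (refls [r])"
    using q assms by (intro refls_subset) auto
  then have "length q \<le> 1"
    using distinct_card[OF q(3)] card_mono[of "{r}" "set (refls q)"] by simp
  moreover have "q \<noteq> []"
  proof
    assume "q = []"
    then have "word_prod [] = word_prod [r]"
      using q(2) assms(1) by simp
    then have "set (refls [r]) \<subseteq> set (refls [])"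
      using assms(1) by (intro refls_subset) auto
    then show False by simp
  qed
  ultimately obtain x where "q = [x]"
    by (cases q) auto
  then show ?thesis
    using q assms(2) by auto
qed

text \<open>All reflections of \<open>p\<close> occur among those of \<open>q\<close>, hence are products of
  letters of \<open>q\<close>. Each letter of \<open>p\<close> is such a reflection conjugated by the
  letters before it, so from left to right all letters of \<open>p\<close> are products of letters
  of \<open>q\<close>.\<close>
lemma reduced_support:
  assumes "set p \<subseteq> R" "set q \<subseteq> R" "word_prod p = word_prod q" "distinct (refls p)"
  shows "set p \<subseteq> set q"
proof -
  have "set a \<subseteq> set q" if "p = a @ b" for a b
    using that
  proof (induction a arbitrary: b rule: rev_induct)
    case Nil
    then show ?case by simp
  next
    case (snoc x a)
    then have a: "set a \<subseteq> set q" and xR: "x \<in> R" and aR: "set a \<subseteq> R" and bR: "set b \<subseteq> R"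
      using assms(1) by auto
    let ?t = "conj_by (word_prod a) x"
    have "?t \<in> set (refls p)"
      using aR xR bR snoc.prems by (simp add: refls_append)
    then have "?t \<in> set (refls q)"
      using refls_subset[OF assms] by auto
    then obtain c y d where cyd: "q = c @ y # d" "?t \<otimes> word_prod c = word_prod c \<otimes> y"
      using exchange[OF assms(2)] by blast
    have R': "set c \<subseteq> R" "y \<in> R"
      using cyd(1) assms(2) by auto
    have "?t = word_prod (c @ y # rev c)"
      using R' aR xR cyd(2) conj_by_eq_iff[of "word_prod c" y ?t]
      by (simp add: word_prod_append word_prod_rev conj_by_def m_assoc)
    \<comment> \<open>undoing the conjugation expresses \<open>x\<close> by letters that are known to be in \<open>q\<close>\<close>
    then have "word_prod (rev a @ (c @ y # rev c) @ a) = x"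
      using R' aR xR
        conj_by_eq_iff[of "word_prod a" x ?t]
      by (simp add: word_prod_append[of "rev a" "(c @ y # rev c) @ a"]
          word_prod_append[of "c @ y # rev c" a] word_prod_rev inv_solve_left'
          del: append_assoc flip: \<open>?t = word_prod (c @ y # rev c)\<close>)
    then have "x \<in> set (rev a @ (c @ y # rev c) @ a)"
      using R' aR xR by (intro gen_in_support) auto
    then show ?case
      using a cyd(1) by auto
  qed
  then show ?thesis by auto
qed

section \<open>Words without repeated letters\<close>

text \<open>If \<open>r\<close> occurs among the reflections of a word, then it is a conjugate of a letter of
  that word by other letters, and so is itself one of the letters.\<close>
lemma distinct_imp_reduced:
  assumes "set p \<subseteq> R" "distinct p"
  shows "distinct (refls p)"
  using assms
proof (induction p)
  case Nil
  then show ?case by simp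
next
  case (Cons r p)
  have rp: "r \<in> R" "set p \<subseteq> R"
    using Cons.prems by auto
  have "r \<notin> set (refls p)"
  proof
    assume "r \<in> set (refls p)"
    then obtain a x b where axb: "p = a @ x # b" "r \<otimes> word_prod a = word_prod a \<otimes> x"
      using exchange rp(2) by blast
    have R': "set a \<subseteq> R" "x \<in> R"
      using axb(1) rp by auto
    have "word_prod (a @ x # rev a) = r"
      using R' rp axb(2) conj_by_eq_iff[of "word_prod a" x r]
      by (simp add: word_prod_append word_prod_rev conj_by_def m_assoc)
    then have "r \<in> set (a @ x # rev a)"
      using R' rp by (intro gen_in_support) auto
    then show False
      using Cons.prems axb(1) by auto
  qed
  then show ?case
    using distinct_refls_Cons[OF rp] Cons by auto
qed

text \<open>A simple reflection can only be the reflection of its own letter: from \<open>r a = a x\<close>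
  the letter \<open>x\<close> is a product of \<open>r\<close> and letters of \<open>a\<close>, and it
  does not occur in \<open>a\<close>.\<close>
lemma gen_reflection_position:
  assumes "set p \<subseteq> R" "distinct p" "r \<in> R" "r \<in> set (refls p)"
  obtains a b where "p = a @ r # b" "r \<otimes> word_prod a = word_prod a \<otimes> r"
proof -
  obtain a x b where axb: "p = a @ x # b" "r \<otimes> word_prod a = word_prod a \<otimes> x"
    using exchange assms by blast
  have R': "set a \<subseteq> R" "x \<in> R"
    using axb(1) assms by auto
  have "word_prod (rev a @ r # a) = x"
    using R' assms(3) axb(2)
    by (simp add: word_prod_append word_prod_rev) (simp add: inv_solve_left')
  then have "x \<in> set (rev a @ r # a)"
    using R' assms(3) by (intro gen_in_support) auto
  then have "x = r"
    using assms(2) axb(1) by auto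
  then show thesis
    using that axb by blast
qed

text \<open>For \<open>a = y a'\<close> the words \<open>y a' r\<close> and \<open>r y a'\<close> represent the same
  element. The first one has \<open>y\<close> among its reflections, hence so has the second one,
  and there its position shows that \<open>y\<close> commutes with \<open>r\<close>. Cancelling
  \<open>y\<close> leaves the same situation for \<open>a'\<close>.\<close>
lemma commutes_letterwise:
  assumes "set a \<subseteq> R" "distinct a" "r \<in> R" "r \<notin> set a"
    and "r \<otimes> word_prod a = word_prod a \<otimes> r"
  shows "\<forall>y\<in>set a. r \<otimes> y = y \<otimes> r"
  using assms
proof (induction a)
  case Nil
  then show ?case by simp
next
  case (Cons y a)
  have R': "y \<in> R" "set a \<subseteq> R"
    using Cons.prems by auto
  have "word_prod ((y # a) @ [r]) = word_prod (r # y # a)"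
    using Cons.prems R' by (simp add: word_prod_append m_assoc)
  then have "set (refls ((y # a) @ [r])) \<subseteq> set (refls (r # y # a))"
    using Cons.prems by (intro refls_subset distinct_imp_reduced) auto
  then have "y \<in> set (refls (r # y # a))"
    by auto
  then obtain c d where cd: "r # y # a = c @ y # d" "y \<otimes> word_prod c = word_prod c \<otimes> y"
    using gen_reflection_position[of "r # y # a" y] Cons.prems by auto
  have "c = [r]"
    using cd(1) Cons.prems by (auto simp: Cons_eq_append_conv)
  then have ry: "r \<otimes> y = y \<otimes> r"
    using cd(2) Cons.prems(3) by simp
  have "y \<otimes> (r \<otimes> word_prod a) = r \<otimes> (y \<otimes> word_prod a)"
    using Cons.prems(3) R' ry by (simp flip: m_assoc)
  also have "\<dots> = y \<otimes> (word_prod a \<otimes> r)"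
    using Cons.prems(3,5) R' by (simp add: m_assoc)
  finally have "r \<otimes> word_prod a = word_prod a \<otimes> r"
    using Cons.prems(3) R' by simp
  then show ?case
    using Cons ry by simp
qed

lemma commutes_with_prod:
  assumes "set a \<subseteq> R" "r \<in> R" "\<forall>y\<in>set a. r \<otimes> y = y \<otimes> r"
  shows "r \<otimes> word_prod a = word_prod a \<otimes> r"
  using assms
proof (induction a)
  case (Cons y a)
  have "r \<otimes> (y \<otimes> word_prod a) = y \<otimes> (r \<otimes> word_prod a)"
    using Cons.prems by (simp flip: m_assoc)
  also have "r \<otimes> word_prod a = word_prod a \<otimes> r"
    using Cons by simp
  finally show ?case
    using Cons.prems by (simp add: m_assoc)
qed auto

section \<open>Length and left descents\<close>

lemma cox_length_le: "set p \<subseteq> R \<Longrightarrow> cox_length W R (word_prod p) \<le> length p"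
  unfolding cox_length_def word_prod_def by (rule Least_le) auto

lemma gens_words:
  assumes "g \<in> carrier W"
  obtains p where "set p \<subseteq> R" "word_prod p = g"
proof -
  have "\<exists>p. set p \<subseteq> R \<and> word_prod p = g"
    using assms unfolding gens_generate[symmetric]
  proof (induction rule: generate.induct)
    case one
    then show ?case by (intro exI[of _ "[]"]) auto
  next
    case (incl h)
    then show ?case by (intro exI[of _ "[h]"]) auto
  next
    case (inv h)
    then show ?case by (intro exI[of _ "[h]"]) auto
  next
    case (eng h1 h2)
    then obtain p q where "set p \<subseteq> R" "word_prod p = h1" "set q \<subseteq> R" "word_prod q = h2"
      by auto
    then show ?case
      by (intro exI[of _ "p @ q"]) (simp add: word_prod_append)
  qed
  then show thesis using that by blast
qed

lemma shortest_word:
  assumes "g \<in> carrier W"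
  obtains p where "set p \<subseteq> R" "word_prod p = g" "length p = cox_length W R g"
proof -
  let ?P = "\<lambda>n. \<exists>rs. set rs \<subseteq> R \<and> length rs = n \<and> word_prod rs = g"
  obtain p where "set p \<subseteq> R" "word_prod p = g"
    using gens_words[OF assms] by blast
  then have "?P (length p)" by auto
  then have "?P (LEAST n. ?P n)" by (rule LeastI)
  then show thesis
    using that unfolding cox_length_def word_prod_def by blast
qed

lemma cox_length_reduced:
  assumes "set p \<subseteq> R" "distinct (refls p)"
  shows "cox_length W R (word_prod p) = length p"
proof (rule antisym)
  obtain q where q: "set q \<subseteq> R" "word_prod q = word_prod p"
      "length q = cox_length W R (word_prod p)"
    using shortest_word[OF word_prod_closed[OF assms(1)]] by blast
  have "length p = card (set (refls p))"
    using distinct_card[OF assms(2)] by simp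
  also have "\<dots> \<le> card (set (refls q))"
    using refls_subset[OF assms(1) q(1) q(2)[symmetric] assms(2)] by (intro card_mono) auto
  also have "\<dots> \<le> length q"
    using card_length[of "refls q"] by simp
  finally show "length p \<le> cox_length W R (word_prod p)"
    using q(3) by simp
qed (rule cox_length_le[OF assms(1)])

lemma cox_length_distinct:
  "set p \<subseteq> R \<Longrightarrow> distinct p \<Longrightarrow> cox_length W R (word_prod p) = length p"
  by (simp add: cox_length_reduced distinct_imp_reduced)

text \<open>A descent \<open>r\<close> must be among the reflections of \<open>p\<close>, since otherwise
  \<open>r p\<close> would have distinct reflections and be longer. Its position forces it to
  commute with the product of the letters before it, and hence with each of them. Conversely a
  letter that can be moved to the front is cancelled by multiplication from the left.\<close>
lemma descent_iff_commutes_before: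
  assumes "set p \<subseteq> R" "distinct p" "p = a @ r # b"
  shows "r \<in> left_descents W R (word_prod p) \<longleftrightarrow> (\<forall>y\<in>set a. r \<otimes> y = y \<otimes> r)"
proof -
  have R': "r \<in> R" "set a \<subseteq> R" "set b \<subseteq> R"
    using assms by auto
  show ?thesis
  proof
    assume r: "r \<in> left_descents W R (word_prod p)"
    have "r \<in> set (refls p)"
    proof (rule ccontr)
      assume "r \<notin> set (refls p)"
      then have "distinct (refls (r # p))"
        using distinct_refls_Cons[of r p] R' assms distinct_imp_reduced by blast
      then have "cox_length W R (r \<otimes> word_prod p) = length (r # p)"
        using cox_length_reduced[of "r # p"] R' assms(1) by simp
      then show False
        using r cox_length_distinct[OF assms(1,2)] by (simp add: left_descents_def)
    qed
    then obtain a' b' where a': "p = a' @ r # b'" "r \<otimes> word_prod a' = word_prod a' \<otimes> r"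
      using gen_reflection_position assms R' by blast
    have "r \<notin> set a" "r \<notin> set b"
      using assms(2,3) by auto
    from append_Cons_eq_iff[OF this, of a' b'] have "a' = a"
      using a'(1) assms(3) by simp
    then show "\<forall>y\<in>set a. r \<otimes> y = y \<otimes> r"
      using a'(2) assms R' by (intro commutes_letterwise) auto
  next
    assume "\<forall>y\<in>set a. r \<otimes> y = y \<otimes> r"
    then have "r \<otimes> word_prod a = word_prod a \<otimes> r"
      using R' by (intro commutes_with_prod) auto
    then have "r \<otimes> word_prod p = word_prod (a @ b)"
      using delete_letter[of a r b r] assms R' by simp
    then have "cox_length W R (r \<otimes> word_prod p) < cox_length W R (word_prod p)"
      using cox_length_distinct[of p] cox_length_distinct[of "a @ b"] assms by simp
    then show "r \<in> left_descents W R (word_prod p)"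
      using R' by (simp add: left_descents_def)
  qed
qed

section \<open>Products of commuting letters\<close>

text \<open>The reversed word begins with the last letter \<open>x\<close> of \<open>p\<close>, which is thus a
  descent and commutes with all letters before it. Cancelling \<open>x\<close> gives a shorter word
  with the same symmetry.\<close>
lemma palindromic_imp_commuting:
  assumes "set p \<subseteq> R" "distinct p" "word_prod (rev p) = word_prod p"
  shows "\<forall>x\<in>set p. \<forall>y\<in>set p. x \<otimes> y = y \<otimes> x"
  using assms
proof (induction p rule: rev_induct)
  case Nil
  then show ?case by simp
next
  case (snoc x p)
  have R': "x \<in> R" "set p \<subseteq> R"
    using snoc.prems by auto
  have "x \<in> left_descents W R (word_prod (x # rev p))"
    using descent_iff_commutes_before[of "x # rev p" "[]" x "rev p"] snoc.prems by simp
  then have "x \<in> left_descents W R (word_prod (p @ [x]))"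
    using snoc.prems(3) by simp
  then have x: "\<forall>y\<in>set p. x \<otimes> y = y \<otimes> x"
    using descent_iff_commutes_before[of "p @ [x]" p x "[]"] snoc.prems by simp
  then have "x \<otimes> word_prod p = word_prod p \<otimes> x"
    using R' by (intro commutes_with_prod)
  then have "x \<otimes> word_prod (rev p) = x \<otimes> word_prod p"
    using snoc.prems(3) R' by (simp add: word_prod_append)
  then have "word_prod (rev p) = word_prod p"
    using R' by simp
  then have "\<forall>x\<in>set p. \<forall>y\<in>set p. x \<otimes> y = y \<otimes> x"
    using snoc by simp
  then show ?case
    using x by auto
qed

lemma commuting_prod_cong:
  assumes "set p \<subseteq> R" "distinct p" "distinct q" "set q = set p"
    and "\<forall>x\<in>set p. \<forall>y\<in>set p. x \<otimes> y = y \<otimes> x"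
  shows "word_prod p = word_prod q"
  using assms
proof (induction p arbitrary: q)
  case Nil
  then show ?case by simp
next
  case (Cons r p)
  then obtain a b where q: "q = a @ r # b"
    by (metis list.set_intros(1) split_list)
  have ab: "set (a @ b) = set p"
    using Cons.prems q by auto
  have R': "r \<in> R" "set p \<subseteq> R" "set a \<subseteq> R" "set b \<subseteq> R"
    using Cons.prems(1) ab by auto
  have "r \<otimes> word_prod a = word_prod a \<otimes> r"
    using R' Cons.prems(5) ab by (intro commutes_with_prod) auto
  then have "word_prod q = r \<otimes> word_prod (a @ b)"
    using R' by (simp add: q word_prod_append m_assoc[symmetric])
  moreover have "word_prod p = word_prod (a @ b)"
    using Cons ab R' q by (intro Cons.IH) auto
  ultimately show ?case by simp
qed

lemma filter_to_front:
  assumes "set p \<subseteq> R"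
    and "\<And>a r b. p = a @ r # b \<Longrightarrow> P r \<Longrightarrow> \<forall>y\<in>set a. r \<otimes> y = y \<otimes> r"
  shows "word_prod p = word_prod (filter P p) \<otimes> word_prod (filter (\<lambda>x. \<not> P x) p)"
  using assms
proof (induction p rule: rev_induct)
  case Nil
  then show ?case by simp
next
  case (snoc x p)
  let ?Y = "filter P p" and ?N = "filter (\<lambda>x. \<not> P x) p"
  have R': "x \<in> R" "set p \<subseteq> R" "set ?Y \<subseteq> R" "set ?N \<subseteq> R"
    using snoc.prems by auto
  have IH: "word_prod p = word_prod ?Y \<otimes> word_prod ?N"
    using snoc.prems R' by (intro snoc.IH) auto
  show ?case
  proof (cases "P x")
    case True
    then have "x \<otimes> word_prod ?N = word_prod ?N \<otimes> x"
      using R' snoc.prems(2)[of p x "[]"] by (intro commutes_with_prod) auto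
    then show ?thesis
      using True R' IH by (simp add: word_prod_append m_assoc)
  next
    case False
    then show ?thesis
      using R' IH by (simp add: word_prod_append m_assoc)
  qed
qed

section \<open>Involution prefixes of a Coxeter element\<close>

lemma involution_iff: "involution W u \<longleftrightarrow> u \<in> carrier W \<and> u \<noteq> \<one> \<and> u \<otimes> u = \<one>"
proof (cases "u \<in> carrier W")
  case True
  have "ord u = 2 \<longleftrightarrow> u \<noteq> \<one> \<and> u [^] (2::nat) = \<one>"
  proof
    assume "ord u = 2"
    then show "u \<noteq> \<one> \<and> u [^] (2::nat) = \<one>"
      using True pow_ord_eq_1[of u] ord_eq_1[of u] by auto
  next
    assume *: "u \<noteq> \<one> \<and> u [^] (2::nat) = \<one>"
    then have "ord u dvd 2" "ord u \<noteq> 1"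
      using True pow_eq_id ord_eq_1 by auto
    then show "ord u = 2"
      using dvd_imp_le[of "ord u" 2] by (cases "ord u = 0") auto
  qed
  then show ?thesis
    using True by (simp add: involution_def numeral_2_eq_2)
qed (simp add: involution_def)

context
  fixes p w
  assumes p: "set p = R" "distinct p" "p \<noteq> []" and w: "w = word_prod p"
begin

abbreviation D where "D \<equiv> left_descents W R w"

lemma D_subset: "D \<subseteq> R"
  by (auto simp: left_descents_def)

lemma descents_commute:
  assumes "r \<in> D" "s \<in> D"
  shows "r \<otimes> s = s \<otimes> r"
proof (cases "r = s")
  case False
  obtain a b where ab: "p = a @ r # b"
    using assms(1) D_subset p(1) by (metis split_list subsetD)
  obtain a' b' where ab': "p = a' @ s # b'"
    using assms(2) D_subset p(1) by (metis split_list subsetD)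
  have "s \<in> set a \<or> r \<in> set a'"
    using ab ab' False
    by (auto simp: append_eq_append_conv2 Cons_eq_append_conv append_eq_Cons_conv)
  moreover have "\<forall>y\<in>set a. r \<otimes> y = y \<otimes> r"
    using descent_iff_commutes_before[OF _ p(2) ab] assms(1) p(1) w by simp
  moreover have "\<forall>y\<in>set a'. s \<otimes> y = y \<otimes> s"
    using descent_iff_commutes_before[OF _ p(2) ab'] assms(2) p(1) w by simp
  ultimately show ?thesis
    by auto
qed auto

text \<open>Reduced words of \<open>u\<close> and of its complement concatenate to a word of \<open>w\<close> of
  length \<open>card R\<close>. By \<open>reduced_support\<close> every element of \<open>R\<close> occurs in it, so
  no letter is repeated, and the palindromic symmetry of the part representing \<open>u\<close> applies.\<close>
lemma involution_prefix_word:
  assumes "u \<in> involution_prefixes W R w"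
  obtains q where "set q \<subseteq> D" "distinct q" "word_prod q = u"
proof -
  have inv: "u \<in> carrier W" "u \<otimes> u = \<one>"
    using assms by (auto simp: involution_prefixes_def involution_iff)
  obtain v where v: "v \<in> carrier W" "w = u \<otimes> v"
      "cox_length W R w = cox_length W R u + cox_length W R v"
    using assms by (auto simp: involution_prefixes_def is_prefix_def)
  obtain q where q: "set q \<subseteq> R" "word_prod q = u" "length q = cox_length W R u"
    using shortest_word[OF inv(1)] by blast
  obtain t where t: "set t \<subseteq> R" "word_prod t = v" "length t = cox_length W R v"
    using shortest_word[OF v(1)] by blast
  have prod: "word_prod (q @ t) = word_prod p"
    using q t v w by (simp add: word_prod_append)
  have "R \<subseteq> set (q @ t)"
    using reduced_support[of p "q @ t"] p prod q(1) t(1) distinct_imp_reduced[of p] by simp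
  then have "set (q @ t) = R"
    using q(1) t(1) by auto
  moreover have "length (q @ t) = card R"
    using q(3) t(3) v(3) w cox_length_distinct[of p] p distinct_card[of p] by simp
  ultimately have dist: "distinct (q @ t)"
    by (metis card_distinct)
  have "word_prod (rev q) = word_prod q"
    using q inv by (simp add: word_prod_rev inv_equality)
  then have comm: "\<forall>x\<in>set q. \<forall>y\<in>set q. x \<otimes> y = y \<otimes> x"
    using palindromic_imp_commuting q(1) dist by simp
  have "set q \<subseteq> D"
  proof
    fix x
    assume "x \<in> set q"
    then obtain a b where ab: "q = a @ x # b"
      by (metis split_list)
    then have "x \<in> left_descents W R (word_prod (q @ t)) \<longleftrightarrow> (\<forall>y\<in>set a. x \<otimes> y = y \<otimes> x)"
      using dist q(1) t(1) by (intro descent_iff_commutes_before[of _ a x "b @ t"]) auto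
    then show "x \<in> D"
      using comm ab prod w by auto
  qed
  then show thesis
    using that[of q] dist q(2) by auto
qed

text \<open>Moving all descents to the front of \<open>p\<close> splits the word into a word for their product
  and a complement whose lengths add up. The product is not trivial because the first letter of
  \<open>p\<close> is always a descent.\<close>
lemma descent_product_involution_prefix:
  assumes "distinct ds" "set ds = D"
  shows "word_prod ds \<in> involution_prefixes W R w"
proof -
  have dsR: "set ds \<subseteq> R"
    using assms D_subset by simp
  let ?Y = "filter (\<lambda>x. x \<in> D) p" and ?N = "filter (\<lambda>x. x \<notin> D) p"
  have comm: "\<forall>x\<in>set ds. \<forall>y\<in>set ds. x \<otimes> y = y \<otimes> x"
    using descents_commute assms by auto
  have Y: "word_prod ds = word_prod ?Y"
    using comm dsR assms p D_subset by (intro commuting_prod_cong) auto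
  have fact: "w = word_prod ds \<otimes> word_prod ?N"
    unfolding Y unfolding w
    using p w descent_iff_commutes_before[of p] by (intro filter_to_front) auto
  have "length ?Y + length ?N = length p"
    by (rule sum_length_filter_compl)
  moreover have "length ?Y = length ds"
    using p assms D_subset by (metis Y cox_length_distinct distinct_filter dsR filter_is_subset)
  ultimately have len: "cox_length W R w = cox_length W R (word_prod ds) + cox_length W R (word_prod ?N)"
    using w p dsR assms(1) cox_length_distinct[of p] cox_length_distinct[of ds]
      cox_length_distinct[of ?N] by (simp add: subset_eq)
  have "word_prod ds \<otimes> word_prod ds = \<one>"
  proof -
    have "word_prod ds = word_prod (rev ds)"
      using dsR assms(1) comm by (intro commuting_prod_cong) auto
    then show ?thesis
      using dsR by (metis word_prod_rev r_inv word_prod_closed)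
  qed
  moreover have "word_prod ds \<noteq> \<one>"
  proof -
    obtain r p' where rp: "p = r # p'"
      using p(3) by (cases p) auto
    then have "r \<in> D"
      using descent_iff_commutes_before[of p "[]" r p'] p w by auto
    then have "ds \<noteq> []"
      using assms(2) by auto
    then show ?thesis
      using cox_length_distinct[OF dsR assms(1)] cox_length_le[of "[]"] by auto
  qed
  ultimately have "involution W (word_prod ds)"
    using dsR by (simp add: involution_iff)
  moreover have "is_prefix W R (word_prod ds) w"
    unfolding is_prefix_def using fact len dsR p(1)
    by (intro conjI bexI[of _ "word_prod ?N"]) auto
  ultimately show ?thesis
    by (simp add: involution_prefixes_def)
qed

text \<open>An involution prefix of the maximal length \<open>card D\<close> is the product of a word with
  distinct letters in \<open>D\<close> that uses up all of \<open>D\<close>; the order of the letters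
  does not matter.\<close>
lemma max_involution_prefixes_eq:
  assumes "distinct ds" "set ds = D"
  shows "max_involution_prefixes W R w = {word_prod ds}"
proof -
  let ?I = "involution_prefixes W R w"
  have dsR: "set ds \<subseteq> R"
    using assms D_subset by simp
  have bound: "cox_length W R u \<le> length ds \<and> (cox_length W R u = length ds \<longrightarrow> u = word_prod ds)"
    if u: "u \<in> ?I" for u
  proof -
    obtain q where q: "set q \<subseteq> D" "distinct q" "word_prod q = u"
      using involution_prefix_word[OF u] by blast
    have len: "cox_length W R u = length q"
      using q D_subset cox_length_distinct[of q] by auto
    have "card (set q) = length q" "card D = length ds"
      using distinct_card[OF q(2)] distinct_card[OF assms(1)] assms(2) by simp_all
    moreover have "finite D"
      using finite_set[of ds] assms(2) by simp
    ultimately have "length q \<le> length ds" "length q = length ds \<Longrightarrow> set q = D"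
      using card_mono[OF _ q(1)] card_subset_eq[OF _ q(1)] by simp_all
    moreover have "word_prod q = word_prod ds" if "set q = D"
      using that q assms D_subset descents_commute by (intro commuting_prod_cong) auto
    ultimately show ?thesis
      using len q(3) by auto
  qed
  have mem: "word_prod ds \<in> ?I"
    using descent_product_involution_prefix[OF assms] .
  have lds: "cox_length W R (word_prod ds) = length ds"
    using cox_length_distinct[OF dsR assms(1)] .
  have "Max (cox_length W R ` ?I) = length ds"
  proof (rule Max_eqI)
    show "finite (cox_length W R ` ?I)"
      by (rule finite_subset[of _ "{..length ds}"]) (use bound in auto)
    show "length ds \<in> cox_length W R ` ?I"
      using mem lds by (intro image_eqI[of _ _ "word_prod ds"]) simp_all
  qed (use bound in auto)
  then have "max_involution_prefixes W R w = {u \<in> ?I. cox_length W R u = length ds}"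
    by (simp add: max_involution_prefixes_def)
  also have "\<dots> = {word_prod ds}"
    using bound mem lds by blast
  finally show ?thesis .
qed

end

end

theorem proposition2p2:
  fixes W :: "('a, 'b) monoid_scheme" and R :: "'a set" and w :: 'a
  assumes "coxeter_system W R"
    and "finite R" and "R \<noteq> {}"
    and "coxeter_element W R w"
  shows "ancestor_property W R w
    \<and> (\<forall>r\<in>left_descents W R w. \<forall>s\<in>left_descents W R w. r \<otimes>\<^bsub>W\<^esub> s = s \<otimes>\<^bsub>W\<^esub> r)
    \<and> (\<forall>ds. distinct ds \<and> set ds = left_descents W R w
          \<longrightarrow> ancestor W R w = foldr (\<otimes>\<^bsub>W\<^esub>) ds \<one>\<^bsub>W\<^esub>)"
proof -
  interpret coxeter W R
    using assms(1) by (simp add: coxeter_def coxeter_axioms_def coxeter_system_def)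
  obtain p where p: "set p = R" "distinct p" "w = word_prod p"
    using assms(4) by (auto simp: coxeter_element_def word_prod_def)
  have ne: "p \<noteq> []"
    using p(1) assms(3) by auto
  note eq = max_involution_prefixes_eq[OF p(1,2) ne p(3)]
  have "finite (left_descents W R w)"
    using assms(2) by (simp add: left_descents_def)
  then obtain ds where "distinct ds" "set ds = left_descents W R w"
    using finite_distinct_list by metis
  then have "card (max_involution_prefixes W R w) = 1"
    using eq by simp
  moreover have "w \<noteq> \<one>\<^bsub>W\<^esub>"
    using cox_length_distinct[of p] cox_length_le[of "[]"] p ne by auto
  ultimately have "ancestor_property W R w"
    by (simp add: ancestor_property_def)
  moreover have "ancestor W R w = word_prod ds"
    if "distinct ds" "set ds = left_descents W R w" for ds
    using eq[OF that] by (simp add: ancestor_def)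
  ultimately show ?thesis
    using descents_commute[OF p(1,2) ne p(3)] unfolding word_prod_def by blast
qed

end
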